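(* Let $R$ be a ring. Then $R$ is a $UJ^{\#}$ ring if and only if $U(R) + (U(R)\cap Z(R)) = J^{\#}(R)$, where $U(R)+(U(R)\cap Z(R))=\{u+v : u\in U(R),\ v\in U(R)\cap Z(R)\}$.
   Context: All rings are associative with identity. $J(R)$ is the Jacobson radical, $U(R)$ the group of units and $Z(R)$ the center of $R$. Define $J^{\#}(R)=\{z\in R : z^n\in J(R)\text{ for some } n\ge 1\}$ (a subset of $R$, not necessarily a subring). A ring $R$ is called a $UJ^{\#}$ ring if $U(R)=1+J^{\#}(R)$. *)

theory Defs
  imports "HOL-Algebra.Ideal"
begin

text \<open>
  Rings are the (not necessarily commutative, possibly zero) unital rings of the locale
  \<^locale>\<open>ring\<close>. The library's ideals are two-sided; the Jacobson radical of a noncommutative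
  ring needs one-sided ones.
\<close>

locale left_ideal = additive_subgroup I R + ring R for I and R (structure) +
  assumes l_closed: "\<lbrakk>a \<in> I; x \<in> carrier R\<rbrakk> \<Longrightarrow> x \<otimes> a \<in> I"

locale maximal_left_ideal = left_ideal +
  assumes proper: "I \<noteq> carrier R"
    and maximal: "\<lbrakk>left_ideal J R; I \<subseteq> J\<rbrakk> \<Longrightarrow> J = I \<or> J = carrier R"

text \<open>
  The intersection is taken inside the carrier, so the zero ring, which has no maximal left
  ideals, is its own Jacobson radical.
\<close>

definition jacobson_radical :: "('a, 'm) ring_scheme \<Rightarrow> 'a set" where
  "jacobson_radical R = carrier R \<inter> \<Inter>{M. maximal_left_ideal M R}"

definition J_sharp :: "('a, 'm) ring_scheme \<Rightarrow> 'a set" where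
  "J_sharp R = {z \<in> carrier R. \<exists>n::nat. n \<ge> 1 \<and> z [^]\<^bsub>R\<^esub> n \<in> jacobson_radical R}"

definition ring_center :: "('a, 'm) ring_scheme \<Rightarrow> 'a set" where
  "ring_center R = {z \<in> carrier R. \<forall>x \<in> carrier R. z \<otimes>\<^bsub>R\<^esub> x = x \<otimes>\<^bsub>R\<^esub> z}"

definition UJ_sharp_ring :: "('a, 'm) ring_scheme \<Rightarrow> bool" where
  "UJ_sharp_ring R \<longleftrightarrow> ring R \<and> Units R = \<one>\<^bsub>R\<^esub> <+\<^bsub>R\<^esub> J_sharp R"

end

theory Submission
  imports Defs
begin

text \<open>
  Adding a central unit \<open>v\<close> to a unit is, up to the factor \<open>v\<close>, subtracting a unit from \<open>\<one>\<close>,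
  and \<open>J\<^sup>#\<close> is stable under multiplication by central elements. This gives the forward
  direction. Conversely, taking \<open>v = - \<one>\<close> puts \<open>U - \<one>\<close> inside \<open>J\<^sup>#\<close>, while \<open>\<one> + J\<^sup># \<subseteq> U\<close> holds
  in every ring, because \<open>\<one> - j\<close> is a factor of \<open>\<one> - j\<^sup>n\<close> and the latter is a unit once \<open>j\<^sup>n\<close>
  is in the Jacobson radical.
\<close>

section \<open>Left ideals and Zorn's lemma\<close>

lemma (in ring) left_idealI:
  assumes "I \<subseteq> carrier R" "\<zero> \<in> I"
    and add: "\<And>a b. a \<in> I \<Longrightarrow> b \<in> I \<Longrightarrow> a \<oplus> b \<in> I"
    and mult: "\<And>x a. x \<in> carrier R \<Longrightarrow> a \<in> I \<Longrightarrow> x \<otimes> a \<in> I"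
  shows "left_ideal I R"
proof -
  have "\<ominus> a \<in> I" if "a \<in> I" for a
    using mult[of "\<ominus> \<one>" a] that assms(1) by (auto simp: l_minus)
  then have "subgroup I (add_monoid R)"
    using assms by unfold_locales (auto simp: a_inv_def)
  then have "additive_subgroup I R"
    by (rule additive_subgroup.intro)
  then show ?thesis
    by (intro left_ideal.intro left_ideal_axioms.intro ring_axioms) (auto intro: mult)
qed

lemma (in left_ideal) one_imp_carrier:
  assumes "\<one> \<in> I"
  shows "I = carrier R"
  using l_closed[OF assms] a_subset by auto

lemma (in ring) left_ideal_principal:
  assumes "a \<in> carrier R"
  shows "left_ideal {y \<otimes> a | y. y \<in> carrier R} R"
proof (rule left_idealI)
  show "\<zero> \<in> {y \<otimes> a | y. y \<in> carrier R}"
    using assms by (auto intro!: exI[of _ \<zero>])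
next
  fix b c assume "b \<in> {y \<otimes> a | y. y \<in> carrier R}" "c \<in> {y \<otimes> a | y. y \<in> carrier R}"
  then show "b \<oplus> c \<in> {y \<otimes> a | y. y \<in> carrier R}"
    using assms by (auto simp: l_distr[symmetric])
next
  fix x b assume "x \<in> carrier R" "b \<in> {y \<otimes> a | y. y \<in> carrier R}"
  then show "x \<otimes> b \<in> {y \<otimes> a | y. y \<in> carrier R}"
    using assms by (auto simp: m_assoc[symmetric])
qed (use assms in auto)

text \<open>Any two members of a chain are comparable, so each sum can be formed inside the larger
  of them. This supplies the upper bounds for Zorn's lemma.\<close>

lemma (in ring) left_ideal_Union_chain:
  assumes ne: "C \<noteq> {}" and chain: "subset.chain {I. left_ideal I R} C"
  shows "left_ideal (\<Union>C) R"
proof -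
  have li: "left_ideal I R" if "I \<in> C" for I
    using chain that by (auto simp: subset.chain_def)
  then have ai: "additive_subgroup I R" if "I \<in> C" for I
    using that left_ideal.axioms(1) by blast
  show ?thesis
  proof (rule left_idealI)
    show "\<Union>C \<subseteq> carrier R" using ai additive_subgroup.a_subset by blast
    show "\<zero> \<in> \<Union>C" using ne ai additive_subgroup.zero_closed by blast
  next
    fix a b assume "a \<in> \<Union>C" "b \<in> \<Union>C"
    then obtain I K where IK: "I \<in> C" "a \<in> I" "K \<in> C" "b \<in> K" by auto
    then have "I \<subseteq> K \<or> K \<subseteq> I"
      using chain by (auto simp: subset_chain_def)
    then show "a \<oplus> b \<in> \<Union>C"
      using IK ai additive_subgroup.a_closed by (metis UnionI in_mono)
  next
    fix x a assume "x \<in> carrier R" "a \<in> \<Union>C"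
    then show "x \<otimes> a \<in> \<Union>C"
      using left_ideal.l_closed[OF li] by blast
  qed
qed

lemma (in ring) proper_left_ideal_subset_maximal:
  assumes I: "left_ideal I R" and "\<one> \<notin> I"
  obtains M where "maximal_left_ideal M R" "I \<subseteq> M"
proof -
  \<comment> \<open>Properness is expressed by omitting \<open>\<one>\<close>, a condition that
    survives unions of chains. A left ideal above a maximal element of \<open>P\<close> either omits
    \<open>\<one>\<close>, hence lies in \<open>P\<close>, or contains \<open>\<one>\<close> and is
    the whole carrier.\<close>
  define P where "P = {K. left_ideal K R \<and> I \<subseteq> K \<and> \<one> \<notin> K}"
  have "\<exists>M\<in>P. \<forall>X\<in>P. M \<subseteq> X \<longrightarrow> X = M"
  proof (rule subset_Zorn_nonempty)
    show "P \<noteq> {}" using assms by (auto simp: P_def)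
  next
    fix C assume C: "C \<noteq> {}" "subset.chain P C"
    then have "left_ideal (\<Union>C) R"
      by (intro left_ideal_Union_chain) (auto simp: subset_chain_def P_def)
    then show "\<Union>C \<in> P"
      using C by (auto simp: subset_chain_def P_def)
  qed
  then obtain M where M: "M \<in> P" "\<And>X. X \<in> P \<Longrightarrow> M \<subseteq> X \<Longrightarrow> X = M" by blast
  have "maximal_left_ideal M R"
  proof (intro maximal_left_ideal.intro maximal_left_ideal_axioms.intro)
    show "left_ideal M R" "M \<noteq> carrier R"
      using M(1) by (auto simp: P_def)
  next
    fix K assume "left_ideal K R" "M \<subseteq> K"
    then show "K = M \<or> K = carrier R"
      using M left_ideal.one_imp_carrier[of K R] by (auto simp: P_def)
  qed
  then show thesis
    using that M(1) by (auto simp: P_def)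
qed

section \<open>The Jacobson radical and units\<close>

lemma (in ring) jacobson_radical_l_closed:
  assumes "x \<in> jacobson_radical R" "a \<in> carrier R"
  shows "a \<otimes> x \<in> jacobson_radical R"
proof -
  have "a \<otimes> x \<in> M" if "maximal_left_ideal M R" for M
    using assms that left_ideal.l_closed[OF maximal_left_ideal.axioms(1)[OF that]]
    by (simp add: jacobson_radical_def)
  then show ?thesis
    using assms by (simp add: jacobson_radical_def)
qed

text \<open>Otherwise the left ideal generated by \<open>\<one> \<ominus> x\<close> would lie in a
  maximal left ideal; that ideal also contains \<open>x\<close>, hence
  \<open>\<one>\<close>.\<close>

lemma (in ring) one_minus_jacobson_radical_left_inverse:
  assumes "x \<in> jacobson_radical R"
  obtains y where "y \<in> carrier R" "y \<otimes> (\<one> \<ominus> x) = \<one>"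
proof -
  have x: "x \<in> carrier R" using assms by (simp add: jacobson_radical_def)
  let ?I = "{y \<otimes> (\<one> \<ominus> x) | y. y \<in> carrier R}"
  have "\<one> \<in> ?I"
  proof (rule ccontr)
    assume "\<one> \<notin> ?I"
    then obtain M where M: "maximal_left_ideal M R" "?I \<subseteq> M"
      using proper_left_ideal_subset_maximal[OF left_ideal_principal, of "\<one> \<ominus> x"] x by auto
    interpret maximal_left_ideal M R by (rule M(1))
    have "\<one> \<otimes> (\<one> \<ominus> x) \<in> M" using M(2) by blast
    moreover have "x \<in> M" using assms M(1) by (auto simp: jacobson_radical_def)
    ultimately have "(\<one> \<ominus> x) \<oplus> x \<in> M" using x by auto
    then have "\<one> \<in> M" using x by (simp add: minus_eq a_assoc l_neg)
    then show False using one_imp_carrier proper by blast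
  qed
  then obtain y where "y \<in> carrier R" "\<one> = y \<otimes> (\<one> \<ominus> x)" by blast
  then show thesis using that by metis
qed

text \<open>The two one-sided inverses agree, since \<open>y = y \<otimes> (a \<otimes> z) = (y
  \<otimes> a) \<otimes> z = z\<close>.\<close>

lemma (in monoid) left_right_inverse_Units:
  assumes "a \<in> carrier G" "y \<in> carrier G" "z \<in> carrier G" "y \<otimes> a = \<one>" "a \<otimes> z = \<one>"
  shows "a \<in> Units G"
  using assms inv_unique[of y a z] by (auto simp: Units_def)

lemma (in ring) one_minus_jacobson_radical_Units:
  assumes "x \<in> jacobson_radical R"
  shows "\<one> \<ominus> x \<in> Units R"
proof -
  have x: "x \<in> carrier R" using assms by (simp add: jacobson_radical_def)
  obtain y where y: "y \<in> carrier R" "y \<otimes> (\<one> \<ominus> x) = \<one>"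
    using one_minus_jacobson_radical_left_inverse[OF assms] .
  \<comment> \<open>\<open>y = \<one> + y x\<close> is again of the form \<open>\<one> - x'\<close>, hence has a left inverse as well.\<close>
  have "\<one> \<ominus> (\<ominus> y) \<otimes> x = y \<otimes> (\<one> \<ominus> x) \<oplus> y \<otimes> x"
    using x y by (simp add: minus_eq l_minus)
  also have "\<dots> = y"
    using x y(1) by (simp add: minus_eq r_distr r_minus a_assoc l_neg)
  finally have "\<one> \<ominus> (\<ominus> y) \<otimes> x = y" .
  then obtain z where "z \<in> carrier R" "z \<otimes> y = \<one>"
    using one_minus_jacobson_radical_left_inverse[OF jacobson_radical_l_closed[OF assms, of "\<ominus> y"]] y(1)
    by auto
  \<comment> \<open>Now \<open>y\<close> has the left inverse \<open>z\<close> and the right inverse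
    \<open>\<one> \<ominus> x\<close>, so \<open>\<one> \<ominus> x\<close> is the inverse of a
    unit.\<close>
  then have "y \<in> Units R"
    using y x by (intro left_right_inverse_Units[of y z "\<one> \<ominus> x"]) auto
  moreover from this have "inv y = \<one> \<ominus> x"
    using y x by (intro inv_unique[of "inv y" y]) auto
  ultimately show ?thesis using Units_inv_Units by metis
qed

section \<open>Roots of radical elements: the set \<open>J_sharp\<close>\<close>

lemma (in ring) one_minus_dvd_one_minus_pow:
  assumes j: "j \<in> carrier R"
  obtains s where "s \<in> carrier R" "s \<otimes> (\<one> \<ominus> j) = \<one> \<ominus> j [^] (n::nat)"
    "(\<one> \<ominus> j) \<otimes> s = \<one> \<ominus> j [^] n"
proof -
  \<comment> \<open>The witness is the geometric sum of the powers of \<open>j\<close> with exponent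
    below \<open>n\<close>, empty for \<open>n = 0\<close>. It commutes with
    \<open>\<one> \<ominus> j\<close>, which gives the factorization on both sides.\<close>
  have "\<exists>s \<in> carrier R. s \<otimes> (\<one> \<ominus> j) = \<one> \<ominus> j [^] n \<and> (\<one> \<ominus> j) \<otimes> s = \<one> \<ominus> j [^] n"
  proof (induction n)
    case 0
    then show ?case using j by (intro bexI[of _ \<zero>]) (auto simp: minus_eq r_neg)
  next
    case (Suc n)
    then obtain s where s: "s \<in> carrier R" "s \<otimes> (\<one> \<ominus> j) = \<one> \<ominus> j [^] n"
      "(\<one> \<ominus> j) \<otimes> s = \<one> \<ominus> j [^] n" by auto
    have comm: "j \<otimes> j [^] n = j [^] n \<otimes> j"
      using nat_pow_Suc2[OF j, of n] by simp
    have telescope: "(\<one> \<ominus> j [^] n) \<oplus> (j [^] n \<ominus> j [^] Suc n) = \<one> \<ominus> j [^] Suc n"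
      using j by (simp add: minus_eq a_assoc r_neg1)
    have "j [^] n \<otimes> (\<one> \<ominus> j) = j [^] n \<ominus> j [^] Suc n"
      using j by (simp add: minus_eq r_distr r_minus)
    moreover have "(\<one> \<ominus> j) \<otimes> j [^] n = j [^] n \<ominus> j [^] Suc n"
      using j by (simp add: minus_eq l_distr l_minus comm)
    ultimately show ?case
      using s j telescope by (intro bexI[of _ "s \<oplus> j [^] n"]) (auto simp: l_distr r_distr)
  qed
  then show thesis using that by blast
qed

text \<open>Centrality splits the power as
  \<open>(v \<otimes> j) [^] n = v [^] n \<otimes> j [^] n\<close>, and the radical absorbs the left
  factor.\<close>

lemma (in ring) J_sharp_central_mult:
  assumes v: "v \<in> ring_center R" and j: "j \<in> J_sharp R"
  shows "v \<otimes> j \<in> J_sharp R"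
proof -
  obtain n :: nat where n: "n \<ge> 1" "j [^] n \<in> jacobson_radical R"
    using j by (auto simp: J_sharp_def)
  have c: "v \<in> carrier R" "j \<in> carrier R" "v \<otimes> j = j \<otimes> v"
    using v j by (auto simp: ring_center_def J_sharp_def)
  then have "(v \<otimes> j) [^] n = v [^] n \<otimes> j [^] n"
    by (intro pow_mult_distrib)
  then show ?thesis
    using n c jacobson_radical_l_closed[of "j [^] n" "v [^] n"] by (auto simp: J_sharp_def)
qed

lemma (in ring) minus_one_central_unit: "\<ominus> \<one> \<in> Units R \<inter> ring_center R"
proof -
  have "\<ominus> \<one> \<otimes> \<ominus> \<one> = \<one>"
    by (simp add: l_minus)
  then have "\<ominus> \<one> \<in> Units R"
    by (intro left_right_inverse_Units[of _ "\<ominus> \<one>" "\<ominus> \<one>"]) auto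
  then show ?thesis
    by (simp add: ring_center_def l_minus r_minus)
qed

lemma (in ring) J_sharp_minus:
  assumes "j \<in> J_sharp R"
  shows "\<ominus> j \<in> J_sharp R"
proof -
  have "j \<in> carrier R" using assms by (simp add: J_sharp_def)
  then have "\<ominus> j = \<ominus> \<one> \<otimes> j"
    by (simp add: l_minus)
  also have "\<dots> \<in> J_sharp R"
    using J_sharp_central_mult assms minus_one_central_unit by blast
  finally show ?thesis .
qed

lemma (in ring) one_minus_J_sharp_Units:
  assumes "j \<in> J_sharp R"
  shows "\<one> \<ominus> j \<in> Units R"
proof -
  obtain n :: nat where j: "j \<in> carrier R" "j [^] n \<in> jacobson_radical R"
    using assms by (auto simp: J_sharp_def)
  obtain s where s: "s \<in> carrier R" "s \<otimes> (\<one> \<ominus> j) = \<one> \<ominus> j [^] n"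
    "(\<one> \<ominus> j) \<otimes> s = \<one> \<ominus> j [^] n"
    using one_minus_dvd_one_minus_pow[OF j(1)] .
  \<comment> \<open>Multiplying the two factorizations by \<open>w\<close> on the outer side makes
    \<open>w \<otimes> s\<close> a left inverse and \<open>s \<otimes> w\<close> a right inverse of
    \<open>\<one> \<ominus> j\<close>.\<close>
  define w where "w = inv (\<one> \<ominus> j [^] n)"
  have u: "\<one> \<ominus> j [^] n \<in> Units R"
    by (rule one_minus_jacobson_radical_Units[OF j(2)])
  then have w: "w \<in> carrier R" by (simp add: w_def)
  have "(w \<otimes> s) \<otimes> (\<one> \<ominus> j) = \<one>"
    using s j w u by (simp add: m_assoc) (simp add: w_def)
  moreover have "(\<one> \<ominus> j) \<otimes> (s \<otimes> w) = \<one>"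
    using s j w u by (simp add: m_assoc[symmetric]) (simp add: w_def)
  ultimately show ?thesis
    using s(1) w j(1) by (intro left_right_inverse_Units[of _ "w \<otimes> s" "s \<otimes> w"]) auto
qed

lemma (in ring) one_plus_J_sharp_subset_Units: "\<one> <+ J_sharp R \<subseteq> Units R"
proof
  fix u assume "u \<in> \<one> <+ J_sharp R"
  then obtain j where j: "j \<in> J_sharp R" "u = \<one> \<oplus> j"
    by (auto simp: a_l_coset_def')
  then have "u = \<one> \<ominus> (\<ominus> j)"
    by (simp add: J_sharp_def minus_eq)
  then show "u \<in> Units R"
    using one_minus_J_sharp_Units[OF J_sharp_minus[OF j(1)]] by (simp only:)
qed

lemma (in ring) minus_one_in_J_sharp:
  assumes "u \<in> \<one> <+ J_sharp R"
  shows "u \<ominus> \<one> \<in> J_sharp R"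
proof -
  obtain j where j: "j \<in> J_sharp R" "u = \<one> \<oplus> j"
    using assms by (auto simp: a_l_coset_def')
  then have "u \<ominus> \<one> = j"
    by (simp add: J_sharp_def minus_eq a_ac r_neg r_neg1 r_neg2)
  then show ?thesis using j by simp
qed

section \<open>Sums of a unit and a central unit\<close>

lemma (in ring) UJ_sharp_ring_iff:
  "UJ_sharp_ring R \<longleftrightarrow>
    {u \<oplus> v | u v. u \<in> Units R \<and> v \<in> Units R \<inter> ring_center R} = J_sharp R"
proof -
  let ?S = "{u \<oplus> v | u v. u \<in> Units R \<and> v \<in> Units R \<inter> ring_center R}"
  show ?thesis
  proof
    assume "UJ_sharp_ring R"
    then have UJ: "Units R = \<one> <+ J_sharp R" unfolding UJ_sharp_ring_def by blast
    show "?S = J_sharp R"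
    proof
      show "?S \<subseteq> J_sharp R"
      proof clarify
        fix u v assume uv: "u \<in> Units R" "v \<in> Units R" "v \<in> ring_center R"
        have c: "u \<in> carrier R" "v \<in> carrier R" "inv v \<in> carrier R"
          using uv by auto
        \<comment> \<open>The unit \<open>w\<close> is chosen so that
          \<open>u \<oplus> v = v \<otimes> (\<one> \<ominus> w)\<close>; the second factor is minus
          an element of \<open>J_sharp R\<close> by hypothesis.\<close>
        define w where "w = \<ominus> (inv v \<otimes> u)"
        have "w = \<ominus> \<one> \<otimes> (inv v \<otimes> u)"
          using c by (simp add: w_def l_minus)
        then have "w \<in> Units R"
          using uv minus_one_central_unit by auto
        then have "\<ominus> (w \<ominus> \<one>) \<in> J_sharp R"
          using UJ minus_one_in_J_sharp J_sharp_minus by blast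
        then have "v \<otimes> \<ominus> (w \<ominus> \<one>) \<in> J_sharp R"
          using J_sharp_central_mult uv by blast
        moreover have "v \<otimes> \<ominus> (w \<ominus> \<one>) = u \<oplus> v"
          using uv c by (simp add: w_def minus_eq minus_add r_distr m_assoc[symmetric])
        ultimately show "u \<oplus> v \<in> J_sharp R" by simp
      qed
      show "J_sharp R \<subseteq> ?S"
      proof
        \<comment> \<open>Here the hypothesis makes \<open>\<one> \<oplus> j\<close> a unit, and
          adding the central unit \<open>\<ominus> \<one>\<close> recovers \<open>j\<close>.\<close>
        fix j assume j: "j \<in> J_sharp R"
        then have "\<one> \<oplus> j \<in> Units R" unfolding UJ by (auto simp: a_l_coset_def')
        moreover have "j = (\<one> \<oplus> j) \<oplus> \<ominus> \<one>"
          using j by (simp add: J_sharp_def a_ac r_neg r_neg1 r_neg2)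
        ultimately show "j \<in> ?S" using minus_one_central_unit by blast
      qed
    qed
  next
    assume S: "?S = J_sharp R"
    have "Units R \<subseteq> \<one> <+ J_sharp R"
    proof
      fix u assume u: "u \<in> Units R"
      then have "u \<oplus> \<ominus> \<one> \<in> J_sharp R"
        using minus_one_central_unit unfolding S[symmetric] by blast
      moreover have "u = \<one> \<oplus> (u \<oplus> \<ominus> \<one>)"
        using Units_closed[OF u] by (simp add: a_ac r_neg r_neg1 r_neg2)
      ultimately show "u \<in> \<one> <+ J_sharp R"
        by (auto simp: a_l_coset_def')
    qed
    then show "UJ_sharp_ring R"
      using one_plus_J_sharp_subset_Units ring_axioms unfolding UJ_sharp_ring_def by blast
  qed
qed

theorem lemma2p12:
  fixes R :: "('a, 'm) ring_scheme"
  assumes "ring R"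
  shows "UJ_sharp_ring R \<longleftrightarrow>
    {u \<oplus>\<^bsub>R\<^esub> v | u v. u \<in> Units R \<and> v \<in> Units R \<inter> ring_center R} = J_sharp R"
  by (rule ring.UJ_sharp_ring_iff[OF assms])

end
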